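(* Let $\alpha,\beta,\gamma\in\mathbb R$ with $A_0:=\alpha+\beta>0$ and $C:=\frac{\alpha+\gamma}{\alpha+\beta}>0$. For integers $k\ge1$ and $r\ge0$ let $$V^{(k)}(r)=\begin{cases}-\beta+\dfrac{A_0}{k}, & r=0,\\[2mm] -\beta+\dfrac rk\left[A_0\displaystyle\sum_{j=r}^{k-1}\frac1j+\beta-\gamma\right], & 1\le r\le k,\\[3mm] -\gamma,& r>k,\end{cases}$$ and for $n\ge1$, $0\le r\le n$, let $V_n(r)=\frac1n\sum_{k=1}^nV^{(k)}(r)$. Let $\Delta_n(r)=V_n(r)-V_n(r-1)$ and $D_n(r)=\frac{n^2}{A_0}\Delta_n(r)$ for $1\le r\le n$. Put $$\ell=\mathrm e^{-2C},\qquad c=\frac{C-1+(C+1)\ell}{2C}.$$ Then: 1. for every $n$ the sequence $\{V_n(r)\}_{r=0}^n$ is unimodal; 2. the largest maximizer $r_n^{\mathrm{opt}}$ of $V_n$ satisfies $r_n^{\mathrm{opt}}/n\to\ell$; 3. $0<c<\frac12$, and uniformly for bounded $u$ such that $\ell n+u$ is an integer in $\{1,\dots,n\}$, $$D_n(\ell n+u)=-\frac C\ell(u-c)+O(n^{-1})\qquad(n\to\infty).$$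
   Context: Empty sums are zero. A finite sequence $\{V(r)\}_{r=0}^n$ is unimodal if there exist $0\le a\le b\le n$ with $V(0)\le\cdots\le V(a)=\cdots=V(b)\ge\cdots\ge V(n)$. "Uniformly for bounded $u$" means: for each $M>0$ there are $K,n_0$ such that the error is at most $K/n$ for all $n\ge n_0$ and all $u$ with $|u|\le M$ and $\ell n+u\in\{1,\dots,n\}$ an integer. Model (uniform random-horizon win–lose–or–draw): the number $N$ of applicants is uniform on $\{1,\dots,n\}$; the rule with threshold $r$ rejects the first $r$ applicants and accepts the first subsequent record; payoff is $\alpha$ if the best applicant is selected, $-\beta$ if a non-best one is selected, $-\gamma$ if none is selected; $V^{(k)}(r)$ is the expected payoff given $N=k$. *)

theory Defs
  imports Complex_Main
begin

definition cond_payoff :: "real \<Rightarrow> real \<Rightarrow> real \<Rightarrow> nat \<Rightarrow> nat \<Rightarrow> real" where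
  "cond_payoff \<alpha> \<beta> \<gamma> k r =
     (if r = 0 then - \<beta> + (\<alpha> + \<beta>) / real k
      else if r \<le> k then
        - \<beta> + real r / real k * ((\<alpha> + \<beta>) * (\<Sum>j = r..<k. 1 / real j) + \<beta> - \<gamma>)
      else - \<gamma>)"

definition payoff :: "real \<Rightarrow> real \<Rightarrow> real \<Rightarrow> nat \<Rightarrow> nat \<Rightarrow> real" where
  "payoff \<alpha> \<beta> \<gamma> n r = 1 / real n * (\<Sum>k = 1..n. cond_payoff \<alpha> \<beta> \<gamma> k r)"

(* Meaningful for 1 \<le> r \<le> n only: at r = 0 the truncated subtraction makes it 0. *)
definition payoff_diff :: "real \<Rightarrow> real \<Rightarrow> real \<Rightarrow> nat \<Rightarrow> nat \<Rightarrow> real" where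
  "payoff_diff \<alpha> \<beta> \<gamma> n r = payoff \<alpha> \<beta> \<gamma> n r - payoff \<alpha> \<beta> \<gamma> n (r - 1)"

definition scaled_diff :: "real \<Rightarrow> real \<Rightarrow> real \<Rightarrow> nat \<Rightarrow> nat \<Rightarrow> real" where
  "scaled_diff \<alpha> \<beta> \<gamma> n r = (real n)\<^sup>2 / (\<alpha> + \<beta>) * payoff_diff \<alpha> \<beta> \<gamma> n r"

definition unimodal_upto :: "(nat \<Rightarrow> real) \<Rightarrow> nat \<Rightarrow> bool" where
  "unimodal_upto V n \<longleftrightarrow>
     (\<exists>a b. a \<le> b \<and> b \<le> n \<and>
        (\<forall>i. i < a \<longrightarrow> V i \<le> V (Suc i)) \<and>
        (\<forall>i. a \<le> i \<and> i < b \<longrightarrow> V i = V (Suc i)) \<and>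
        (\<forall>i. b \<le> i \<and> i < n \<longrightarrow> V i \<ge> V (Suc i)))"

definition largest_maximizer :: "(nat \<Rightarrow> real) \<Rightarrow> nat \<Rightarrow> nat" where
  "largest_maximizer V n = Max {r. r \<le> n \<and> (\<forall>s\<le>n. V s \<le> V r)}"

end

theory Submission
  imports Defs
begin

text \<open>
  Write \<open>H\<close> and \<open>Q\<close> for the sums of \<open>1 / k\<close> and of \<open>1 / k\<^sup>2\<close> over \<open>r \<le> k \<le> n\<close>. The increment of the
  conditional payoff at \<open>r\<close> vanishes for \<open>k < r\<close> and is \<open>1 / k\<close> times an affine function of the sum of
  \<open>1 / j\<close> over \<open>r \<le> j < k\<close> otherwise, so the increment of the payoff is a positive multiple of
  \<open>H\<^sup>2 - 2 C H - Q\<close>. This is negative when \<open>H < C\<close>, and as long as \<open>H \<ge> C\<close> it decreases in \<open>r\<close>, so it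
  changes sign only once. Since \<open>0 < Q \<le> H / r\<close>, the sign change happens where
  \<open>H \<approx> ln (n / r)\<close> equals \<open>2 C\<close> up to \<open>1 / r\<close>, that is at \<open>r = l n + O(1)\<close>. The trapezoidal rule gives
  \<open>H = ln (n / r) + 1 / (2 r) + 1 / (2 n) + O(n\<^sup>-\<^sup>2)\<close>, hence the expansion.
\<close>

section \<open>Reciprocal sums and the increment of the payoff\<close>

definition recip_sum :: "nat \<Rightarrow> nat \<Rightarrow> real" where
  "recip_sum n r = (\<Sum>k = r..n. 1 / real k)"

definition recip_sq_sum :: "nat \<Rightarrow> nat \<Rightarrow> real" where
  "recip_sq_sum n r = (\<Sum>k = r..n. 1 / (real k)\<^sup>2)"

text \<open>This is the second elementary symmetric function of the reciprocals of r, ..., n minus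
  \<open>C\<close> times the first, with the pair sum already rewritten through squares. For 1 <= r
  <= n, multiplying it by (\<alpha> + \<beta>) / n gives the increment of the payoff at r.\<close>

definition gain :: "real \<Rightarrow> nat \<Rightarrow> nat \<Rightarrow> real" where
  "gain C n r = ((recip_sum n r)\<^sup>2 - 2 * C * recip_sum n r - recip_sq_sum n r) / 2"

lemma recip_sum_rec: "r \<le> n \<Longrightarrow> recip_sum n r = 1 / real r + recip_sum n (Suc r)"
  unfolding recip_sum_def by (rule sum.atLeast_Suc_atMost)

lemma recip_sq_sum_rec: "r \<le> n \<Longrightarrow> recip_sq_sum n r = 1 / (real r)\<^sup>2 + recip_sq_sum n (Suc r)"
  unfolding recip_sq_sum_def by (rule sum.atLeast_Suc_atMost)

lemma recip_sum_pos:
  assumes "1 \<le> r" "r \<le> n"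
  shows "0 < recip_sum n r"
  unfolding recip_sum_def using assms by (intro sum_pos) auto

lemma recip_sq_sum_pos:
  assumes "1 \<le> r" "r \<le> n"
  shows "0 < recip_sq_sum n r"
  unfolding recip_sq_sum_def using assms by (intro sum_pos) auto

lemma recip_sq_sum_le:
  assumes "1 \<le> r"
  shows "recip_sq_sum n r \<le> recip_sum n r / real r"
  unfolding recip_sq_sum_def recip_sum_def sum_divide_distrib
proof (rule sum_mono)
  fix k assume "k \<in> {r..n}"
  then show "1 / (real k)\<^sup>2 \<le> 1 / real k / real r"
    using assms by (auto simp: power2_eq_square intro!: divide_left_mono mult_left_mono)
qed

text \<open>The left side runs over the pairs r <= j < k <= n. Squaring the reciprocal sum counts
  each such pair twice and adds the diagonal, which is \<open>recip_sq_sum\<close>.\<close>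

lemma sum_recip_mult_partial_sum:
  assumes "r \<le> n"
  shows "(\<Sum>k = r..n. 1 / real k * (\<Sum>j = r..<k. 1 / real j))
    = ((recip_sum n r)\<^sup>2 - recip_sq_sum n r) / 2"
  using assms
proof (induction n rule: dec_induct)
  case base
  show ?case by (simp add: recip_sum_def recip_sq_sum_def power_divide)
next
  case (step n)
  have [simp]: "recip_sum (Suc n) r = recip_sum n r + 1 / real (Suc n)"
    "recip_sq_sum (Suc n) r = recip_sq_sum n r + 1 / (real (Suc n))\<^sup>2"
    using step.hyps by (simp_all add: recip_sum_def recip_sq_sum_def)
  have "(\<Sum>j = r..<Suc n. 1 / real j) = recip_sum n r"
    by (simp add: recip_sum_def atLeastLessThanSuc_atLeastAtMost)
  then have "(\<Sum>k = r..Suc n. 1 / real k * (\<Sum>j = r..<k. 1 / real j))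
      = ((recip_sum n r)\<^sup>2 - recip_sq_sum n r) / 2 + 1 / real (Suc n) * recip_sum n r"
    using step by (simp del: of_nat_Suc)
  also have "\<dots> = ((recip_sum (Suc n) r)\<^sup>2 - recip_sq_sum (Suc n) r) / 2"
    by (simp add: power2_sum power_divide add_divide_distrib diff_divide_distrib del: of_nat_Suc)
  finally show ?case .
qed

text \<open>For r = s + 1 with s >= 1, the prefactor s of the lower payoff turns the extra summand 1
  / s into 1, so everything except one copy of the bracket cancels. The separate value at threshold
  0 is exactly what makes the same formula hold for r = 1, where no summand 1 / s exists.\<close>

lemma cond_payoff_diff:
  assumes "1 \<le> r" "r \<le> k"
  shows "cond_payoff \<alpha> \<beta> \<gamma> k r - cond_payoff \<alpha> \<beta> \<gamma> k (r - 1)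
    = 1 / real k * ((\<alpha> + \<beta>) * (\<Sum>j = r..<k. 1 / real j) - (\<alpha> + \<gamma>))"
proof (cases "r = 1")
  case True
  then show ?thesis using assms by (simp add: cond_payoff_def field_simps)
next
  case False
  then obtain s where s: "r = Suc s" "1 \<le> s" using assms by (cases r) auto
  have "(\<Sum>j = s..<k. 1 / real j) = 1 / real s + (\<Sum>j = Suc s..<k. 1 / real j)"
    using s assms by (intro sum.atLeast_Suc_lessThan) auto
  then show ?thesis using s assms by (simp add: cond_payoff_def field_simps)
qed

text \<open>The branches agree at the boundary: at threshold k the sum is empty and the prefactor is
  1, which leaves -\<gamma>, the value for all larger thresholds.\<close>

lemma cond_payoff_diff_eq_0:
  assumes "1 \<le> k" "k < r"
  shows "cond_payoff \<alpha> \<beta> \<gamma> k r - cond_payoff \<alpha> \<beta> \<gamma> k (r - 1) = 0"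
  using assms by (cases "r - 1 = k") (auto simp: cond_payoff_def)

lemma gain_eq_half_diff:
  "gain C n r = ((recip_sum n r)\<^sup>2 - recip_sq_sum n r) / 2 - C * recip_sum n r"
  by (simp add: gain_def diff_divide_distrib)

lemma payoff_diff_eq_gain:
  assumes "\<alpha> + \<beta> > 0" "1 \<le> r" "r \<le> n"
  shows "payoff_diff \<alpha> \<beta> \<gamma> n r
    = (\<alpha> + \<beta>) / real n * gain ((\<alpha> + \<gamma>) / (\<alpha> + \<beta>)) n r"
proof -
  have "(\<Sum>k = 1..n. cond_payoff \<alpha> \<beta> \<gamma> k r - cond_payoff \<alpha> \<beta> \<gamma> k (r - 1))
    = (\<Sum>k = r..n. cond_payoff \<alpha> \<beta> \<gamma> k r - cond_payoff \<alpha> \<beta> \<gamma> k (r - 1))"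
    using assms by (intro sum.mono_neutral_right) (auto intro: cond_payoff_diff_eq_0[simplified])
  also have "\<dots> = (\<Sum>k = r..n. 1 / real k * ((\<alpha> + \<beta>) * (\<Sum>j = r..<k. 1 / real j) - (\<alpha> + \<gamma>)))"
    using assms by (intro sum.cong cond_payoff_diff) auto
  also have "\<dots> = (\<alpha> + \<beta>) * (\<Sum>k = r..n. 1 / real k * (\<Sum>j = r..<k. 1 / real j))
      - (\<alpha> + \<gamma>) * recip_sum n r"
    by (simp add: recip_sum_def sum_distrib_left sum_subtractf right_diff_distrib ac_simps)
  also have "\<dots> = (\<alpha> + \<beta>) * (((recip_sum n r)\<^sup>2 - recip_sq_sum n r) / 2
      - (\<alpha> + \<gamma>) / (\<alpha> + \<beta>) * recip_sum n r)"
    unfolding sum_recip_mult_partial_sum[OF assms(3)]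
    using assms(1) by (simp add: right_diff_distrib)
  also have "\<dots> = (\<alpha> + \<beta>) * gain ((\<alpha> + \<gamma>) / (\<alpha> + \<beta>)) n r"
    by (simp only: gain_eq_half_diff)
  finally show ?thesis
    by (simp add: payoff_diff_def payoff_def sum_subtractf flip: diff_divide_distrib)
qed

section \<open>Persistence of the sign and unimodality\<close>

lemma gain_factor:
  "gain C n r = (recip_sum n r * (recip_sum n r - 2 * C) - recip_sq_sum n r) / 2"
  by (simp add: gain_def power2_eq_square algebra_simps)

text \<open>The square of the new term 1 / r cancels against its contribution to
  \<open>recip_sq_sum\<close>. What remains has its sign decided by comparing
  \<open>recip_sum n (Suc r)\<close> with \<open>C\<close>.\<close>

lemma gain_rec:
  assumes "1 \<le> r" "r \<le> n"
  shows "gain C n r = gain C n (Suc r) + (recip_sum n (Suc r) - C) / real r"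
  using assms unfolding gain_def recip_sum_rec[OF assms(2)] recip_sq_sum_rec[OF assms(2)]
  by (simp add: field_simps power2_eq_square)

text \<open>Only the sign persists; \<open>gain\<close> itself need not be monotone. If the
  remaining sum is at least \<open>C\<close>, the recursion makes \<open>gain\<close> no larger at
  the next index. Otherwise the sum lies between 0 and 2 C, and both terms of
  \<open>gain_factor\<close> push the value below zero.\<close>

lemma gain_nonpos_Suc:
  assumes "C > 0" "1 \<le> r" "Suc r \<le> n" "gain C n r \<le> 0"
  shows "gain C n (Suc r) \<le> 0"
proof (cases "C \<le> recip_sum n (Suc r)")
  case True
  then have "0 \<le> (recip_sum n (Suc r) - C) / real r" by simp
  then show ?thesis using gain_rec[of r n C] assms by linarith
next
  case False
  have "recip_sum n (Suc r) * (recip_sum n (Suc r) - 2 * C) \<le> 0"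
    using False assms recip_sum_pos[of "Suc r" n] by (intro mult_nonneg_nonpos) auto
  then show ?thesis
    using recip_sq_sum_pos[of "Suc r" n] assms unfolding gain_factor by simp
qed

lemma unimodal_uptoI:
  assumes "\<And>i. Suc (Suc i) \<le> n \<Longrightarrow> V (Suc i) \<le> V i \<Longrightarrow> V (Suc (Suc i)) \<le> V (Suc i)"
  shows "unimodal_upto V n"
proof -
  \<comment> \<open>The first index from which the sequence stops increasing; the alternative
    \<open>i = n\<close> guarantees that it exists. It serves as both ends of the plateau, so the
    equality clause is vacuous.\<close>
  define a where "a = (LEAST i. i = n \<or> V (Suc i) \<le> V i)"
  have a: "a = n \<or> V (Suc a) \<le> V a"
    unfolding a_def by (rule LeastI[of _ n]) simp
  have "a \<le> n" unfolding a_def by (rule Least_le) simp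
  have below: "V i \<le> V (Suc i)" if "i < a" for i
    using not_less_Least[of i "\<lambda>i. i = n \<or> V (Suc i) \<le> V i"] that unfolding a_def by auto
  have above: "V (Suc i) \<le> V i" if "a \<le> i" "i < n" for i
    using that
  proof (induction i rule: dec_induct)
    case base
    then show ?case using a by auto
  next
    case (step i)
    then show ?case using assms[of i] by simp
  qed
  show ?thesis unfolding unimodal_upto_def
    using \<open>a \<le> n\<close> below above by (intro exI[of _ a]) auto
qed

section \<open>Logarithmic bounds and the location of the sign change\<close>

lemma ln_Suc_minus_ln_bounds:
  assumes "1 \<le> k"
  shows "ln (real (Suc k)) - ln (real k) \<le> 1 / real k"
    and "1 / real (Suc k) \<le> ln (real (Suc k)) - ln (real k)"
proof -
  \<comment> \<open>Both bounds are ln x <= x - 1, taken at (k + 1) / k and then at its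
    reciprocal.\<close>
  have "ln (real (Suc k) / real k) \<le> real (Suc k) / real k - 1"
    using assms by (intro ln_le_minus_one) auto
  then show "ln (real (Suc k)) - ln (real k) \<le> 1 / real k"
    using assms by (simp add: ln_div field_simps)
  have "ln (real k / real (Suc k)) \<le> real k / real (Suc k) - 1"
    using assms by (intro ln_le_minus_one) auto
  also have "\<dots> = - (1 / real (Suc k))" by (simp add: field_simps)
  finally show "1 / real (Suc k) \<le> ln (real (Suc k)) - ln (real k)"
    using assms by (simp add: ln_div)
qed

lemma ln_le_recip_sum:
  assumes "1 \<le> r" "r \<le> n"
  shows "ln (real (Suc n)) - ln (real r) \<le> recip_sum n r"
proof -
  have "ln (real (Suc n)) - ln (real r) = (\<Sum>k = r..n. ln (real (Suc k)) - ln (real k))"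
    using assms by (subst sum_Suc_diff) auto
  also have "\<dots> \<le> recip_sum n r"
    unfolding recip_sum_def using assms by (intro sum_mono ln_Suc_minus_ln_bounds) auto
  finally show ?thesis .
qed

text \<open>A right-endpoint estimate, so the sum starts one index later than in
  \<open>ln_le_recip_sum\<close>. This offset is the source of the + 1 in
  \<open>threshold_le_of_gain_nonneg\<close>.\<close>

lemma recip_sum_Suc_le_ln:
  assumes "1 \<le> r" "r \<le> n"
  shows "recip_sum n (Suc r) \<le> ln (real n) - ln (real r)"
proof -
  have "recip_sum n (Suc r) = (\<Sum>k = r..<n. 1 / real (Suc k))"
    unfolding recip_sum_def
    by (subst atLeastLessThanSuc_atLeastAtMost[symmetric], rule sum.shift_bounds_Suc_ivl)
  also have "\<dots> \<le> (\<Sum>k = r..<n. ln (real (Suc k)) - ln (real k))"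
    using assms by (intro sum_mono ln_Suc_minus_ln_bounds) auto
  also have "\<dots> = ln (real n) - ln (real r)"
    using assms by (subst sum_Suc_diff') auto
  finally show ?thesis .
qed

lemma threshold_le_of_gain_nonneg:
  assumes "1 \<le> r" "r \<le> n" "0 \<le> gain C n r"
  shows "real r \<le> exp (- 2 * C) * real n + 1"
proof (cases "r = 1")
  case True
  then show ?thesis by simp
next
  case False
  then obtain s where s: "r = Suc s" "1 \<le> s" using assms by (cases r) auto
  have "0 < recip_sum n r * (recip_sum n r - 2 * C)"
    using assms recip_sq_sum_pos[of r n] unfolding gain_factor by simp
  then have "2 * C < recip_sum n r"
    using recip_sum_pos[OF assms(1,2)] by (simp add: zero_less_mult_iff)
  also have "\<dots> \<le> ln (real n) - ln (real s)"
    using recip_sum_Suc_le_ln[of s n] s assms by simp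
  finally have "ln (real s) \<le> - 2 * C + ln (real n)" by simp
  then have "exp (ln (real s)) \<le> exp (- 2 * C + ln (real n))" by (simp only: exp_le_cancel_iff)
  then have "real s \<le> exp (- 2 * C) * real n"
    using s assms unfolding exp_add by simp
  then show ?thesis using s by simp
qed

text \<open>Bounding the square sum by H / r, where H is \<open>recip_sum n r\<close>, and dividing
  by H > 0 leaves H <= 2 C + 1 / r. With the logarithmic lower bound this reads x exp (-1 / r) <= r,
  and replacing the exponential by 1 - 1 / r costs at most x / r <= e.\<close>

lemma threshold_ge_of_gain_nonpos:
  assumes "1 \<le> r" "r \<le> n" "gain C n r \<le> 0"
  shows "exp (- 2 * C) * real n - exp 1 \<le> real r"
proof -
  define x where "x = exp (- 2 * C) * real (Suc n)"
  have r: "real r \<ge> 1" using assms by simp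
  have "recip_sum n r * (recip_sum n r - 2 * C) \<le> recip_sum n r * (1 / real r)"
    using assms recip_sq_sum_le[of r n] unfolding gain_factor by simp
  then have "recip_sum n r - 2 * C \<le> 1 / real r"
    using recip_sum_pos[OF assms(1,2)] mult_le_cancel_left_pos by blast
  then have "ln (real (Suc n)) - 2 * C - 1 / real r \<le> ln (real r)"
    using ln_le_recip_sum[OF assms(1,2)] by linarith
  then have "exp (- 2 * C + ln (real (Suc n)) + (- (1 / real r))) \<le> exp (ln (real r))"
    by (subst exp_le_cancel_iff) linarith
  then have *: "x * exp (- (1 / real r)) \<le> real r"
    using r unfolding exp_add x_def by simp
  \<comment> \<open>The crude bound \<open>1 / r \<le> 1\<close> already makes \<open>r\<close> proportional to \<open>n\<close>, which sharpens the estimate.\<close>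
  have "exp (- 1) \<le> exp (- (1 / real r))" using r by simp
  then have "x * exp (- 1) \<le> x * exp (- (1 / real r))"
    by (intro mult_left_mono) (auto simp: x_def)
  then have "x * exp (- 1) \<le> real r" using * by linarith
  then have crude: "x / real r \<le> exp 1"
    using r by (simp add: exp_minus field_simps)
  have "x * (1 + - (1 / real r)) \<le> x * exp (- (1 / real r))"
    by (intro mult_left_mono exp_ge_add_one_self) (auto simp: x_def)
  then have "x - x / real r \<le> real r" using * by (simp add: algebra_simps)
  moreover have "exp (- 2 * C) * real n \<le> x" unfolding x_def by (simp add: algebra_simps)
  ultimately show ?thesis using crude by linarith
qed

section \<open>The largest maximizer and its limit ratio\<close>

lemma largest_maximizer_is_maximizer:
  fixes V :: "nat \<Rightarrow> real" and n :: nat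
  defines "m \<equiv> largest_maximizer V n"
  shows "m \<le> n" and "\<And>s. s \<le> n \<Longrightarrow> V s \<le> V m"
proof -
  let ?S = "{r. r \<le> n \<and> (\<forall>s\<le>n. V s \<le> V r)}"
  have fin: "finite ?S" by (rule finite_subset[of _ "{..n}"]) auto
  \<comment> \<open>An attained maximal value shows that the set of maximizers is nonempty, without
    which its \<open>Max\<close> would be unspecified.\<close>
  have "Max (V ` {..n}) \<in> V ` {..n}" by (rule Max_in) auto
  then obtain r where r: "r \<le> n" "V r = Max (V ` {..n})" by (metis atMost_iff imageE)
  have "V s \<le> V r" if "s \<le> n" for s using that unfolding r(2) by (intro Max_ge) auto
  with r(1) have "r \<in> ?S" by blast
  then have "m \<in> ?S" unfolding m_def largest_maximizer_def using fin by (intro Max_in) auto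
  then show "m \<le> n" and "\<And>s. s \<le> n \<Longrightarrow> V s \<le> V m" by auto
qed

lemma payoff_le_iff_gain:
  assumes "\<alpha> + \<beta> > 0" "Suc r \<le> n"
  shows "payoff \<alpha> \<beta> \<gamma> n (Suc r) \<le> payoff \<alpha> \<beta> \<gamma> n r
    \<longleftrightarrow> gain ((\<alpha> + \<gamma>) / (\<alpha> + \<beta>)) n (Suc r) \<le> 0"
proof -
  have "0 < (\<alpha> + \<beta>) / real n" using assms by simp
  moreover have "payoff \<alpha> \<beta> \<gamma> n (Suc r) - payoff \<alpha> \<beta> \<gamma> n r
    = (\<alpha> + \<beta>) / real n * gain ((\<alpha> + \<gamma>) / (\<alpha> + \<beta>)) n (Suc r)"
    using payoff_diff_eq_gain[of \<alpha> \<beta> "Suc r" n \<gamma>] assms by (simp add: payoff_diff_def)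
  ultimately show ?thesis
    by (metis diff_le_0_iff_le linorder_not_le mult_pos_pos mult_le_0_iff less_eq_real_def)
qed

lemma payoff_ge_iff_gain:
  assumes "\<alpha> + \<beta> > 0" "Suc r \<le> n"
  shows "payoff \<alpha> \<beta> \<gamma> n r \<le> payoff \<alpha> \<beta> \<gamma> n (Suc r)
    \<longleftrightarrow> 0 \<le> gain ((\<alpha> + \<gamma>) / (\<alpha> + \<beta>)) n (Suc r)"
proof -
  have "0 < (\<alpha> + \<beta>) / real n" using assms by simp
  moreover have "payoff \<alpha> \<beta> \<gamma> n (Suc r) - payoff \<alpha> \<beta> \<gamma> n r
    = (\<alpha> + \<beta>) / real n * gain ((\<alpha> + \<gamma>) / (\<alpha> + \<beta>)) n (Suc r)"
    using payoff_diff_eq_gain[of \<alpha> \<beta> "Suc r" n \<gamma>] assms by (simp add: payoff_diff_def)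
  ultimately show ?thesis
    by (metis diff_ge_0_iff_ge zero_le_mult_iff linorder_not_le less_eq_real_def)
qed

text \<open>Comparing a maximizer m with its two neighbours is enough: \<open>gain\<close> is
  nonnegative at m and nonpositive at m + 1. At m = 0 and m = n one neighbour is missing, but the
  corresponding bound is immediate there.\<close>

lemma largest_maximizer_payoff_near:
  fixes \<alpha> \<beta> \<gamma> C l :: real
  assumes "\<alpha> + \<beta> > 0" "1 \<le> n" and C_def: "C = (\<alpha> + \<gamma>) / (\<alpha> + \<beta>)"
    and l_def: "l = exp (- 2 * C)" and "l \<le> 1"
  shows "\<bar>real (largest_maximizer (payoff \<alpha> \<beta> \<gamma> n) n) - l * real n\<bar> \<le> exp 1 + 1"
proof -
  define m where "m = largest_maximizer (payoff \<alpha> \<beta> \<gamma> n) n"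
  note m = largest_maximizer_is_maximizer[where V = "payoff \<alpha> \<beta> \<gamma> n" and n = n, folded m_def]
  have e: "0 < exp (1::real)" "0 < l" by (simp_all add: l_def)
  have "real m \<le> l * real n + 1"
  proof (cases m)
    case 0
    then show ?thesis by (simp add: l_def)
  next
    case (Suc s)
    have "0 \<le> gain C n m"
      using payoff_ge_iff_gain[of \<alpha> \<beta> s n \<gamma>] m(1) m(2)[of s] assms(1) Suc by (simp add: C_def)
    then show ?thesis using threshold_le_of_gain_nonneg[of m n C] m(1) Suc by (simp add: l_def)
  qed
  moreover have "l * real n - exp 1 - 1 \<le> real m"
  proof (cases "m = n")
    case True
    have "l * real n \<le> 1 * real n" using assms by (intro mult_right_mono) auto
    then show ?thesis using True e by linarith
  next
    case False
    then have "Suc m \<le> n" using m(1) by simp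
    then have "gain C n (Suc m) \<le> 0"
      using payoff_le_iff_gain[of \<alpha> \<beta> m n \<gamma>] m(2) assms(1) by (simp add: C_def)
    then show ?thesis
      using threshold_ge_of_gain_nonpos[of "Suc m" n C] \<open>Suc m \<le> n\<close> by (simp add: l_def)
  qed
  ultimately show ?thesis using e unfolding m_def[symmetric] abs_le_iff by linarith
qed

lemma ratio_tendsto_of_bounded_diff:
  fixes f :: "nat \<Rightarrow> real"
  assumes "\<And>n. 1 \<le> n \<Longrightarrow> \<bar>f n - l * real n\<bar> \<le> B"
  shows "(\<lambda>n. f n / real n) \<longlonglongrightarrow> l"
proof -
  have "(\<lambda>n. f n / real n - l) \<longlonglongrightarrow> 0"
  proof (rule tendsto_0_le)
    show "\<forall>\<^sub>F n in sequentially. norm (f n / real n - l) \<le> norm (\<bar>B\<bar> / real n) * 1"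
      using eventually_ge_at_top[of 1]
    proof eventually_elim
      case (elim n)
      then have "f n / real n - l = (f n - l * real n) / real n" by (simp add: field_simps)
      moreover have "\<bar>f n - l * real n\<bar> \<le> \<bar>B\<bar>" using assms[OF elim] by linarith
      ultimately show ?case by (simp add: abs_divide divide_right_mono)
    qed
    show "(\<lambda>n. \<bar>B\<bar> / real n) \<longlonglongrightarrow> 0" by (rule lim_const_over_n)
  qed
  then show ?thesis by (rule LIM_zero_cancel)
qed

section \<open>Bounds for the shift \<open>c\<close>\<close>

lemma shift_const_bounds:
  fixes C l c :: real
  assumes "C > 0" "l = exp (- 2 * C)" "c = (C - 1 + (C + 1) * l) / (2 * C)"
  shows "0 < c" "c < 1 / 2"
proof -
  \<comment> \<open>\<open>f C\<close> is the numerator of \<open>c\<close> multiplied by exp (2 C)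
    = 1 / l. Since f vanishes at 0, positivity of f' suffices, and this is 1 - 2 x < exp (-2
    x).\<close>
  define f where "f = (\<lambda>x::real. (x - 1) * exp (2 * x) + x + 1)"
  have "f 0 < f C"
  proof (rule DERIV_pos_imp_increasing_open[OF \<open>C > 0\<close>])
    fix x :: real assume x: "0 < x" "x < C"
    have "(f has_real_derivative (2 * x - 1) * exp (2 * x) + 1) (at x)"
      unfolding f_def by (auto intro!: derivative_eq_intros simp: algebra_simps)
    moreover have "(2 * x - 1) * exp (2 * x) + 1 > 0"
    proof -
      have "1 + - (2 * x) < exp (- (2 * x))" using x exp_minus_greater[of "2 * x"] by simp
      then have "(1 - 2 * x) * exp (2 * x) < exp (- (2 * x)) * exp (2 * x)"
        by (intro mult_strict_right_mono) auto
      also have "\<dots> = 1" by (simp flip: exp_add)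
      finally show ?thesis by (simp add: algebra_simps)
    qed
    ultimately show "\<exists>y. (f has_real_derivative y) (at x) \<and> 0 < y" by blast
  qed (auto simp: f_def intro!: continuous_intros)
  then have "0 < f C" by (simp add: f_def)
  then have "0 < f C * l" using assms by simp
  also have "f C * l = C - 1 + (C + 1) * l"
  proof -
    have "exp (2 * C) * l = 1" using assms by (simp flip: exp_add)
    then have "(C - 1) * (exp (2 * C) * l) = C - 1" by simp
    then show ?thesis unfolding f_def by (simp add: algebra_simps)
  qed
  finally show "0 < c" using assms by simp
  \<comment> \<open>The bound c < 1 / 2 amounts to (1 + C) l < 1, that is, 1 + C < exp (2
    C).\<close>
  have "1 + 2 * C \<le> exp (2 * C)" by (rule exp_ge_add_one_self)
  then have "1 + C < exp (2 * C)" using \<open>C > 0\<close> by linarith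
  then have "(1 + C) * l < exp (2 * C) * l" using assms by (intro mult_strict_right_mono) auto
  also have "\<dots> = 1" using assms by (simp flip: exp_add)
  finally have "C - 1 + (C + 1) * l < C" by (simp add: algebra_simps)
  then show "c < 1 / 2" using assms(1,3) by (simp add: divide_less_eq)
qed

section \<open>Trapezoidal and telescoping approximations of the reciprocal sums\<close>

lemma ln_one_plus_cubic_bounds:
  fixes t :: real
  assumes "0 \<le> t"
  shows "t - t\<^sup>2 / 2 \<le> ln (1 + t)" and "ln (1 + t) \<le> t - t\<^sup>2 / 2 + t ^ 3 / 3"
proof -
  \<comment> \<open>Both Taylor remainders vanish at 0, and their derivatives x^2 / (1 + x) and x^3
    / (1 + x) are nonnegative.\<close>
  have "(\<lambda>t. ln (1 + t) - (t - t\<^sup>2 / 2)) 0 \<le> (\<lambda>t. ln (1 + t) - (t - t\<^sup>2 / 2)) t"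
  proof (rule DERIV_nonneg_imp_nondecreasing[OF assms])
    fix x :: real assume "0 \<le> x"
    then have "((\<lambda>t. ln (1 + t) - (t - t\<^sup>2 / 2)) has_real_derivative x\<^sup>2 / (1 + x)) (at x)"
      by (auto intro!: derivative_eq_intros simp: field_simps power2_eq_square)
    then show "\<exists>y. ((\<lambda>t. ln (1 + t) - (t - t\<^sup>2 / 2)) has_real_derivative y) (at x) \<and> 0 \<le> y"
      using \<open>0 \<le> x\<close> by (intro exI[of _ "x\<^sup>2 / (1 + x)"]) simp
  qed
  then show "t - t\<^sup>2 / 2 \<le> ln (1 + t)" by simp
  have "(\<lambda>t. t - t\<^sup>2 / 2 + t ^ 3 / 3 - ln (1 + t)) 0 \<le> (\<lambda>t. t - t\<^sup>2 / 2 + t ^ 3 / 3 - ln (1 + t)) t"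
  proof (rule DERIV_nonneg_imp_nondecreasing[OF assms])
    fix x :: real assume "0 \<le> x"
    then have "((\<lambda>t. t - t\<^sup>2 / 2 + t ^ 3 / 3 - ln (1 + t)) has_real_derivative x ^ 3 / (1 + x)) (at x)"
      by (auto intro!: derivative_eq_intros simp: field_simps power2_eq_square power3_eq_cube)
    then show "\<exists>y. ((\<lambda>t. t - t\<^sup>2 / 2 + t ^ 3 / 3 - ln (1 + t)) has_real_derivative y) (at x) \<and> 0 \<le> y"
      using \<open>0 \<le> x\<close> by (intro exI[of _ "x ^ 3 / (1 + x)"]) simp
  qed
  then show "ln (1 + t) \<le> t - t\<^sup>2 / 2 + t ^ 3 / 3" by simp
qed

text \<open>With t = 1 / k, the mean of the endpoint values and the logarithmic increment share the
  terms t - t^2 / 2, and each remainder lies between 0 and t^3.\<close>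

lemma trapezoid_recip_error:
  assumes "1 \<le> k"
  shows "\<bar>(1 / real k + 1 / real (Suc k)) / 2 - (ln (real (Suc k)) - ln (real k))\<bar> \<le> 1 / real k ^ 3"
proof -
  define t where "t = 1 / real k"
  have t: "0 < t" using assms by (simp add: t_def)
  have "ln (real (Suc k)) - ln (real k) = ln (1 + t)"
  proof -
    have "1 + t = real (Suc k) / real k" using assms by (simp add: t_def field_simps)
    then show ?thesis using assms by (simp add: ln_div del: of_nat_Suc)
  qed
  moreover have "(1 / real k + 1 / real (Suc k)) / 2 = t - t\<^sup>2 / 2 + t ^ 3 / (2 * (1 + t))"
  proof -
    have "1 / real (Suc k) = t / (1 + t)" using assms by (simp add: t_def field_simps)
    then have "(1 / real k + 1 / real (Suc k)) / 2 = (t + t / (1 + t)) / 2" by (simp add: t_def)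
    also have "\<dots> = t - t\<^sup>2 / 2 + t ^ 3 / (2 * (1 + t))"
      using t by (simp add: divide_simps) (simp add: algebra_simps power2_eq_square power3_eq_cube)
    finally show ?thesis .
  qed
  moreover have "t ^ 3 / (2 * (1 + t)) \<le> t ^ 3 / 1" using t by (intro divide_left_mono) auto
  moreover have "0 \<le> t ^ 3 / (2 * (1 + t))" "0 \<le> t ^ 3" using t by auto
  moreover have "1 / real k ^ 3 = t ^ 3" by (simp add: t_def power_one_over)
  ultimately show ?thesis using ln_one_plus_cubic_bounds[of t] t unfolding abs_le_iff by linarith
qed

text \<open>Summing the trapezoids gives half weight to the two end terms, hence the corrections 1 /
  (2 r) and 1 / (2 n). The at most n local errors are each bounded by 1 / r^3; this is O(1 / n^2)
  once r is proportional to n.\<close>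

lemma recip_sum_trapezoid:
  assumes "1 \<le> r" "r \<le> n"
  shows "\<bar>recip_sum n r - (ln (real n) - ln (real r) + 1 / (2 * real r) + 1 / (2 * real n))\<bar>
    \<le> real n / real r ^ 3"
proof -
  have "recip_sum n r - (ln (real n) - ln (real r) + 1 / (2 * real r) + 1 / (2 * real n))
    = (\<Sum>k = r..<n. (1 / real k + 1 / real (Suc k)) / 2 - (ln (real (Suc k)) - ln (real k)))"
    using assms(2)
    by (induction n rule: dec_induct) (simp_all add: recip_sum_def add_divide_distrib mult.commute del: of_nat_Suc)
  also have "\<bar>\<dots>\<bar> \<le> (\<Sum>k = r..<n. 1 / real r ^ 3)"
  proof (rule order_trans[OF sum_abs], rule sum_mono)
    fix k assume k: "k \<in> {r..<n}"
    then have "1 / real k ^ 3 \<le> 1 / real r ^ 3"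
      using assms by (intro divide_left_mono power_mono mult_pos_pos) auto
    then show "\<bar>(1 / real k + 1 / real (Suc k)) / 2 - (ln (real (Suc k)) - ln (real k))\<bar>
        \<le> 1 / real r ^ 3"
      using trapezoid_recip_error[of k] k assms by simp
  qed
  also have "\<dots> \<le> real n / real r ^ 3" using assms by (simp add: divide_right_mono)
  finally show ?thesis .
qed

text \<open>For k < n, 1 / k^2 is compared with the telescoping term 1 / k - 1 / (k + 1), at a cost
  of at most 1 / k^3. The last term 1 / n^2 has no partner and goes into the error.\<close>

lemma recip_sq_sum_approx:
  assumes "1 \<le> r" "r \<le> n"
  shows "\<bar>recip_sq_sum n r - (1 / real r - 1 / real n)\<bar> \<le> real n / real r ^ 3 + 1 / (real n)\<^sup>2"
proof -
  have "recip_sq_sum n r - (1 / real r - 1 / real n)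
    = (\<Sum>k = r..<n. 1 / (real k)\<^sup>2 - (1 / real k - 1 / real (Suc k))) + 1 / (real n)\<^sup>2"
    using assms(2)
    by (induction n rule: dec_induct) (simp_all add: recip_sq_sum_def)
  moreover have "\<bar>\<Sum>k = r..<n. 1 / (real k)\<^sup>2 - (1 / real k - 1 / real (Suc k))\<bar>
      \<le> (\<Sum>k = r..<n. 1 / real r ^ 3)"
  proof (rule order_trans[OF sum_abs], rule sum_mono)
    fix k assume k: "k \<in> {r..<n}"
    then have "0 < real k" using assms by auto
    then have "1 / (real k)\<^sup>2 - (1 / real k - 1 / real (Suc k)) = 1 / ((real k)\<^sup>2 * real (Suc k))"
      by (simp add: divide_simps) (simp add: algebra_simps power2_eq_square)
    then have "\<bar>1 / (real k)\<^sup>2 - (1 / real k - 1 / real (Suc k))\<bar> = 1 / ((real k)\<^sup>2 * real (Suc k))"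
      by simp
    also have "\<dots> \<le> 1 / real k ^ 3"
      using \<open>0 < real k\<close>
      by (intro divide_left_mono) (auto simp: power3_eq_cube power2_eq_square)
    also have "\<dots> \<le> 1 / real r ^ 3"
      using k assms by (intro divide_left_mono power_mono mult_pos_pos) auto
    finally show "\<bar>1 / (real k)\<^sup>2 - (1 / real k - 1 / real (Suc k))\<bar> \<le> 1 / real r ^ 3" .
  qed
  moreover have "(\<Sum>k = r..<n. 1 / real r ^ 3) \<le> real n / real r ^ 3"
    using assms by (simp add: divide_right_mono)
  moreover have "0 \<le> 1 / (real n)\<^sup>2" by simp
  ultimately show ?thesis by linarith
qed

section \<open>Expansion at r = l n + u\<close>

lemma recip_near:
  fixes l N \<rho> u M :: real
  assumes "0 < l" "0 < N" "\<bar>u\<bar> \<le> M" "\<rho> = l * N + u" "l * N / 2 \<le> \<rho>"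
  shows "\<bar>N * (1 / \<rho>) - 1 / l\<bar> \<le> 2 * M / l\<^sup>2 / N"
proof -
  have \<rho>: "0 < \<rho>" using assms(1,2,5) by (smt (verit) divide_pos_pos mult_pos_pos)
  have "N * (1 / \<rho>) - 1 / l = - u / (l * \<rho>)"
    using assms(1,4) \<rho> by (simp add: field_simps)
  then have "\<bar>N * (1 / \<rho>) - 1 / l\<bar> = \<bar>u\<bar> / (l * \<rho>)" using assms(1) \<rho> by (simp add: abs_mult)
  also have "\<dots> \<le> M / (l * (l * N / 2))"
    using assms \<rho> by (intro frac_le mult_left_mono mult_pos_pos) auto
  also have "\<dots> = 2 * M / l\<^sup>2 / N" using assms by (simp add: field_simps power2_eq_square)
  finally show ?thesis .
qed

text \<open>Converts the error n / r^3 of both approximations, after scaling by n, into O(1 /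
  n).\<close>

lemma cube_ratio_le:
  fixes l N \<rho> :: real
  assumes "0 < l" "0 < N" "l * N / 2 \<le> \<rho>"
  shows "N * (N / \<rho> ^ 3) \<le> 8 / l ^ 3 / N"
proof -
  have pos: "0 < l * N / 2" using assms by simp
  then have "0 < \<rho>" using assms(3) by linarith
  with pos have "N * N / \<rho> ^ 3 \<le> N * N / (l * N / 2) ^ 3"
    using assms by (intro divide_left_mono power_mono mult_pos_pos zero_less_power) auto
  also have "\<dots> = 8 / l ^ 3 / N" using assms by (simp add: field_simps power3_eq_cube)
  finally show ?thesis by simp
qed

text \<open>Writing r = l n (1 + x) with x = u / (l n), the identity ln l = -2 C cancels the
  constant and leaves -ln (1 + x). The three parts of the bound come from the trapezoidal remainder,
  from linearizing this logarithm and from replacing n / r by 1 / l.\<close>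

lemma recip_sum_expansion:
  fixes C l M u :: real
  defines "l \<equiv> exp (- 2 * C)"
  assumes "1 \<le> r" "r \<le> n" "\<bar>u\<bar> \<le> M" "2 * M / l \<le> real n" "real r = l * real n + u"
  shows "\<bar>real n * (recip_sum n r - 2 * C) - (- u / l + 1 / (2 * l) + 1 / 2)\<bar>
    \<le> (8 / l ^ 3 + 2 * M\<^sup>2 / l\<^sup>2 + M / l\<^sup>2) / real n"
proof -
  define N where "N = real n"
  define x where "x = u / (l * N)"
  have N: "0 < N" using assms by (simp add: N_def)
  have l: "0 < l" by (simp add: l_def)
  \<comment> \<open>The lower bound on n enters here: it gives both r >= l n / 2 and |x| <= 1 / 2,
    the range of the logarithm estimate.\<close>
  have half: "M \<le> l * N / 2" using assms(5) l by (simp add: N_def field_simps)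
  then have r: "l * N / 2 \<le> real r" using assms unfolding N_def by linarith
  have x: "\<bar>x\<bar> \<le> 1 / 2"
    using half assms(4) l N by (simp add: x_def abs_mult field_simps)
  have "real r = l * N * (1 + x)" using l N assms by (simp add: x_def N_def field_simps)
  moreover have "0 < 1 + x" using x by linarith
  ultimately have ln: "ln N - ln (real r) - 2 * C = - ln (1 + x)"
    using l N by (simp add: ln_mult l_def)
  have "\<bar>ln (1 + x) - x\<bar> \<le> 2 * x\<^sup>2" using x by (rule abs_ln_one_plus_x_minus_x_bound)
  then have "N * \<bar>ln (1 + x) - x\<bar> \<le> N * (2 * x\<^sup>2)" using N by (intro mult_left_mono) auto
  moreover have "N * (2 * x\<^sup>2) = 2 * u\<^sup>2 / l\<^sup>2 / N"
    using l N by (simp add: x_def power_divide power_mult_distrib power2_eq_square)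
  moreover have "2 * u\<^sup>2 / l\<^sup>2 / N \<le> 2 * M\<^sup>2 / l\<^sup>2 / N"
    using assms(4) l N by (intro divide_right_mono mult_left_mono)
      (auto simp: abs_le_square_iff[symmetric])
  moreover have "\<bar>N * ln (1 + x) - u / l\<bar> = N * \<bar>ln (1 + x) - x\<bar>"
  proof -
    have "N * ln (1 + x) - u / l = N * (ln (1 + x) - x)"
      using l N by (simp add: x_def field_simps)
    then show ?thesis using N by (simp add: abs_mult)
  qed
  ultimately have A: "\<bar>N * ln (1 + x) - u / l\<bar> \<le> 2 * M\<^sup>2 / l\<^sup>2 / N" by linarith
  have B: "\<bar>N * (1 / real r) - 1 / l\<bar> \<le> 2 * M / l\<^sup>2 / N"
    using l N assms r by (intro recip_near[of l N u M]) (auto simp: N_def)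
  define E where "E = recip_sum n r - (ln N - ln (real r) + 1 / (2 * real r) + 1 / (2 * N))"
  have "\<bar>E\<bar> \<le> N / real r ^ 3"
    using recip_sum_trapezoid[OF assms(2,3)] by (simp add: E_def N_def)
  then have "N * \<bar>E\<bar> \<le> N * (N / real r ^ 3)" using N by (intro mult_left_mono) auto
  also have "\<dots> \<le> 8 / l ^ 3 / N" using l N r by (rule cube_ratio_le)
  finally have E: "\<bar>N * E\<bar> \<le> 8 / l ^ 3 / N" using N by (simp add: abs_mult)
  have "\<bar>p - q + s / 2\<bar> \<le> P + Q + S / 2" if "\<bar>p\<bar> \<le> P" "\<bar>q\<bar> \<le> Q" "\<bar>s\<bar> \<le> S" for p q s P Q S :: real
    using that by linarith
  note this[OF E A B]
  moreover have "N * (recip_sum n r - 2 * C) - (- u / l + 1 / (2 * l) + 1 / 2)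
    = N * E - (N * ln (1 + x) - u / l) + (N * (1 / real r) - 1 / l) / 2"
  proof -
    have *: "recip_sum n r - 2 * C = E - ln (1 + x) + 1 / real r / 2 + 1 / N / 2"
      unfolding E_def using ln by (simp add: mult.commute)
    show ?thesis unfolding * using N by (simp add: algebra_simps diff_divide_distrib)
  qed
  moreover have "(8 / l ^ 3 + 2 * M\<^sup>2 / l\<^sup>2 + M / l\<^sup>2) / real n
    = 8 / l ^ 3 / N + 2 * M\<^sup>2 / l\<^sup>2 / N + (2 * M / l\<^sup>2 / N) / 2"
    by (simp add: N_def add_divide_distrib)
  ultimately show ?thesis unfolding N_def[symmetric] by (simp only:)
qed

lemma recip_sq_sum_expansion:
  fixes l M u :: real
  assumes "0 < l" "1 \<le> r" "r \<le> n" "\<bar>u\<bar> \<le> M" "2 * M / l \<le> real n" "real r = l * real n + u"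
  shows "\<bar>real n * recip_sq_sum n r - (1 / l - 1)\<bar> \<le> (8 / l ^ 3 + 1 + 2 * M / l\<^sup>2) / real n"
proof -
  define N where "N = real n"
  define E where "E = recip_sq_sum n r - (1 / real r - 1 / N)"
  have N: "0 < N" using assms by (simp add: N_def)
  have "M \<le> l * N / 2" using assms by (simp add: N_def field_simps)
  then have r: "l * N / 2 \<le> real r" using assms unfolding N_def by linarith
  have B: "\<bar>N * (1 / real r) - 1 / l\<bar> \<le> 2 * M / l\<^sup>2 / N"
    using N assms r by (intro recip_near[of l N u M]) (auto simp: N_def)
  have "\<bar>E\<bar> \<le> N / real r ^ 3 + 1 / N\<^sup>2"
    using recip_sq_sum_approx[OF assms(2,3)] by (simp add: E_def N_def)
  then have "N * \<bar>E\<bar> \<le> N * (N / real r ^ 3 + 1 / N\<^sup>2)" using N by (intro mult_left_mono) auto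
  also have "\<dots> = N * (N / real r ^ 3) + 1 / N"
    using N by (simp add: distrib_left power2_eq_square)
  also have "\<dots> \<le> 8 / l ^ 3 / N + 1 / N" using cube_ratio_le[OF assms(1) N r] by simp
  finally have "\<bar>N * E\<bar> \<le> 8 / l ^ 3 / N + 1 / N" using N by (simp add: abs_mult)
  moreover have "N * recip_sq_sum n r - (1 / l - 1) = N * E + (N * (1 / real r) - 1 / l)"
    unfolding E_def using N by (simp add: algebra_simps)
  ultimately show ?thesis using B unfolding N_def[symmetric] by (simp add: add_divide_distrib)
qed

text \<open>With \<delta> = H - 2 C, where H is \<open>recip_sum n r\<close>, \<open>gain\<close> is
  C \<delta> + \<delta>^2 / 2 minus half the square sum. Here n \<delta> stays bounded, so after
  scaling by n the quadratic term is O(1 / n) and the other two have explicit limits.\<close>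

lemma gain_expansion:
  fixes C l c M :: real
  assumes "C > 0" "l = exp (- 2 * C)" "c = (C - 1 + (C + 1) * l) / (2 * C)"
  obtains K where "\<And>n r u. 1 \<le> r \<Longrightarrow> r \<le> n \<Longrightarrow> \<bar>u\<bar> \<le> M \<Longrightarrow> 2 * M / l \<le> real n \<Longrightarrow>
    real r = l * real n + u \<Longrightarrow> \<bar>real n * gain C n r - (- (C / l) * (u - c))\<bar> \<le> K / real n"
proof
  define K1 where "K1 = 8 / l ^ 3 + 2 * M\<^sup>2 / l\<^sup>2 + M / l\<^sup>2"
  define K2 where "K2 = 8 / l ^ 3 + 1 + 2 * M / l\<^sup>2"
  define A where "A = M / l + 1 / (2 * l) + 1 / 2"
  fix n r u
  assume r: "1 \<le> r" "r \<le> n" and u: "\<bar>u\<bar> \<le> M" and n: "2 * M / l \<le> real n"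
    and ru: "real r = l * real n + u"
  have l: "0 < l" using assms by simp
  have N: "1 \<le> real n" using r by simp
  define a where "a = - u / l + 1 / (2 * l) + 1 / 2"
  define \<delta> where "\<delta> = recip_sum n r - 2 * C"
  have d: "\<bar>real n * \<delta> - a\<bar> \<le> K1 / real n"
    using recip_sum_expansion[of r n u M C] r u n ru assms(2) by (simp add: K1_def a_def \<delta>_def)
  have q: "\<bar>real n * recip_sq_sum n r - (1 / l - 1)\<bar> \<le> K2 / real n"
    using recip_sq_sum_expansion[OF l r u n ru] by (simp add: K2_def)
  have "0 \<le> K1" using l u by (simp add: K1_def)
  then have "K1 / real n \<le> K1 / 1" using N by (intro divide_left_mono) auto
  moreover have "\<bar>a\<bar> \<le> A"
  proof -
    have "\<bar>- u / l\<bar> \<le> M / l" using u l by (simp add: divide_right_mono)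
    moreover have "0 < 1 / (2 * l)" using l by simp
    ultimately show ?thesis unfolding a_def A_def abs_le_iff by linarith
  qed
  ultimately have "\<bar>real n * \<delta>\<bar> \<le> A + K1" using d by linarith
  then have "\<bar>real n * \<delta>\<bar>\<^sup>2 \<le> (A + K1)\<^sup>2" by (intro power_mono) auto
  then have "(real n * \<delta>)\<^sup>2 / real n \<le> (A + K1)\<^sup>2 / real n" by (simp add: divide_right_mono)
  then have "real n * \<delta>\<^sup>2 \<le> (A + K1)\<^sup>2 / real n"
    using N by (simp add: power2_eq_square mult_ac)
  then have sq: "\<bar>real n * \<delta>\<^sup>2\<bar> \<le> (A + K1)\<^sup>2 / real n" by simp
  have "C * \<bar>real n * \<delta> - a\<bar> \<le> C * (K1 / real n)" using d assms by (intro mult_left_mono) auto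
  then have Cd: "\<bar>C * (real n * \<delta> - a)\<bar> \<le> C * (K1 / real n)" using assms by (simp add: abs_mult)
  \<comment> \<open>This is where \<open>c\<close> originates: it collects the terms free of u in
    the two limits.\<close>
  have target: "- (C / l) * (u - c) = C * a - (1 / l - 1) / 2"
    unfolding assms(3) a_def using assms(1) l by (simp add: field_simps)
  have gain: "gain C n r = ((2 * C + \<delta>) * \<delta> - recip_sq_sum n r) / 2"
    unfolding gain_factor \<delta>_def by (simp add: algebra_simps)
  have "real n * gain C n r - (- (C / l) * (u - c))
    = C * (real n * \<delta> - a) + real n * \<delta>\<^sup>2 / 2 - (real n * recip_sq_sum n r - (1 / l - 1)) / 2"
    unfolding target gain by (simp add: field_simps power2_eq_square)
  moreover have "\<bar>p + q / 2 - s / 2\<bar> \<le> P + Q / 2 + S / 2"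
    if "\<bar>p\<bar> \<le> P" "\<bar>q\<bar> \<le> Q" "\<bar>s\<bar> \<le> S" for p q s P Q S :: real
    using that by linarith
  note this[OF Cd sq q]
  moreover have "C * (K1 / real n) + (A + K1)\<^sup>2 / real n / 2 + K2 / real n / 2
      = (C * K1 + (A + K1)\<^sup>2 / 2 + K2 / 2) / real n"
    by (simp add: add_divide_distrib mult.commute)
  \<comment> \<open>The numerator becomes the witness \<open>K\<close>. It depends on
    \<open>C\<close>, \<open>l\<close> and \<open>M\<close> only, which gives the uniformity in
    u.\<close>
  ultimately show "\<bar>real n * gain C n r - (- (C / l) * (u - c))\<bar>
      \<le> (C * K1 + (A + K1)\<^sup>2 / 2 + K2 / 2) / real n"
    by (simp only:)
qed

theorem mainTheorem8:
  fixes \<alpha> \<beta> \<gamma> A0 C l c :: real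
  assumes A0_def: "A0 = \<alpha> + \<beta>"
    and A0_pos: "A0 > 0"
    and C_def: "C = (\<alpha> + \<gamma>) / (\<alpha> + \<beta>)"
    and C_pos: "C > 0"
    and l_def: "l = exp (- 2 * C)"
    and c_def: "c = (C - 1 + (C + 1) * l) / (2 * C)"
  shows "(\<forall>n\<ge>1. unimodal_upto (payoff \<alpha> \<beta> \<gamma> n) n)
    \<and> (\<lambda>n. real (largest_maximizer (payoff \<alpha> \<beta> \<gamma> n) n) / real n) \<longlonglongrightarrow> l
    \<and> 0 < c \<and> c < 1 / 2
    \<and> (\<forall>M>0. \<exists>K n0. \<forall>n\<ge>n0. \<forall>u r.
          \<bar>u\<bar> \<le> M \<and> r \<in> {1..n} \<and> real r = l * real n + u \<longrightarrow>
          \<bar>scaled_diff \<alpha> \<beta> \<gamma> n r - (- (C / l) * (u - c))\<bar> \<le> K / real n)"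
proof (intro conjI)
  have AB: "\<alpha> + \<beta> > 0" using A0_def A0_pos by simp
  have l: "0 < l" "l \<le> 1" using C_pos by (simp_all add: l_def)
  show "\<forall>n\<ge>1. unimodal_upto (payoff \<alpha> \<beta> \<gamma> n) n"
    using gain_nonpos_Suc[OF C_pos] by (auto intro!: unimodal_uptoI simp: payoff_le_iff_gain AB C_def)
  show "(\<lambda>n. real (largest_maximizer (payoff \<alpha> \<beta> \<gamma> n) n) / real n) \<longlonglongrightarrow> l"
    using largest_maximizer_payoff_near[OF AB _ C_def l_def l(2)]
    by (intro ratio_tendsto_of_bounded_diff[where B = "exp 1 + 1"]) blast
  show "0 < c" "c < 1 / 2" using shift_const_bounds[OF C_pos l_def c_def] by auto
  show "\<forall>M>0. \<exists>K n0. \<forall>n\<ge>n0. \<forall>u r.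
          \<bar>u\<bar> \<le> M \<and> r \<in> {1..n} \<and> real r = l * real n + u \<longrightarrow>
          \<bar>scaled_diff \<alpha> \<beta> \<gamma> n r - (- (C / l) * (u - c))\<bar> \<le> K / real n"
  proof (intro allI impI)
    fix M :: real
    obtain K where K: "\<And>n r u. 1 \<le> r \<Longrightarrow> r \<le> n \<Longrightarrow> \<bar>u\<bar> \<le> M \<Longrightarrow> 2 * M / l \<le> real n \<Longrightarrow>
        real r = l * real n + u \<Longrightarrow> \<bar>real n * gain C n r - (- (C / l) * (u - c))\<bar> \<le> K / real n"
      using gain_expansion[OF C_pos l_def c_def] by blast
    \<comment> \<open>The factor n^2 / (\<alpha> + \<beta>) turns the coefficient (\<alpha> +
      \<beta>) / n of \<open>gain\<close> into n.\<close>
    have scaled: "scaled_diff \<alpha> \<beta> \<gamma> n r = real n * gain C n r" if "1 \<le> r" "r \<le> n" for n r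
      using payoff_diff_eq_gain[OF AB that, of \<gamma>] AB that
      by (simp add: scaled_diff_def C_def power2_eq_square)
    show "\<exists>K n0. \<forall>n\<ge>n0. \<forall>u r.
          \<bar>u\<bar> \<le> M \<and> r \<in> {1..n} \<and> real r = l * real n + u \<longrightarrow>
          \<bar>scaled_diff \<alpha> \<beta> \<gamma> n r - (- (C / l) * (u - c))\<bar> \<le> K / real n"
    proof (intro exI allI impI)
      fix n u r
      \<comment> \<open>The ceiling is the witness for \<open>n0\<close>: from there on the
        condition 2 M / l <= n of the expansion holds.\<close>
      assume "nat \<lceil>2 * M / l\<rceil> \<le> n"
        and "\<bar>u\<bar> \<le> M \<and> r \<in> {1..n} \<and> real r = l * real n + u"
      moreover from this have "2 * M / l \<le> real n" by linarith
      ultimately show "\<bar>scaled_diff \<alpha> \<beta> \<gamma> n r - (- (C / l) * (u - c))\<bar> \<le> K / real n"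
        using K[of r n u] scaled[of r n] by auto
    qed
  qed
qed

end
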